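(* Let $\mathbf{A}=(a_1,\dots,a_r)$ be an $r$-tuple of positive integers with $\gcd(a_1,\dots,a_r)=1$. Then for every integer $t\ge 0$ the polynomial part (first Sylvester wave) $W_1(t;\mathbf{A})$ of the denumerant $d(t;\mathbf{A})$ is given by $$ W_1(t;\mathbf{A})=\frac{1}{a_1\cdots a_r}\sum_{j=0}^{r-1}\ \sum_{j_1+\cdots+j_r=j}(-1)^j\binom{t+r-j-1}{t}\frac{\tilde\beta_{j_1}(a_1)\cdots\tilde\beta_{j_r}(a_r)}{j_1!\cdots j_r!}, $$ where the inner sum is over nonnegative integers $j_1,\dots,j_r$ and $\tilde\beta_j(a)$ are the reciprocal degenerate Bernoulli numbers.
   Context: The denumerant $d(t;\mathbf{A})$ is the number of $(x_1,\dots,x_r)\in\mathbb{Z}_{\ge 0}^r$ with $\sum_j a_jx_j=t$; equivalently $\prod_{j=1}^r (1-x^{a_j})^{-1}=\sum_{t\ge 0}d(t;\mathbf{A})x^t$. The first Sylvester wave $W_1(t;\mathbf{A})$ is the residue at $z=0$ (coefficient of $z^{-1}$) of $$\frac{e^{zt}}{(1-e^{-a_1z})\cdots(1-e^{-a_rz})};$$ it is a polynomial in $t$. For a positive integer $m$ the reciprocal degenerate Bernoulli numbers $\tilde\beta_k(m)$, $k\ge0$, are defined by the expansion about $x=1$ $$\frac{m(1-x)}{1-x^m}=\sum_{k=0}^\infty(-1)^k\frac{\tilde\beta_k(m)}{k!}(1-x)^k.$$ *)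

theory Defs
  imports "HOL-Complex_Analysis.Complex_Analysis"
begin

(* The tuple (a_1, ..., a_r) is a list, with zero-based indices.  The argument t ranges over
   all complex numbers, so that polynomiality in t makes sense; the value of the integrand at the
   singularity z = 0 itself is irrelevant for the residue. *)
definition first_sylvester_wave :: "nat list \<Rightarrow> complex \<Rightarrow> complex" where
  "first_sylvester_wave A t =
     residue (\<lambda>z. exp (z * t) / (\<Prod>i<length A. 1 - exp (- (of_nat (A ! i) * z)))) 0"

(* The expansion of m (1 - x) / (1 - x^m) in powers of u = 1 - x; the variable fps_X stands for u.
   For m > 0 the quotient of formal power series is exact, since the common factor u cancels. *)
definition rdb_series :: "nat \<Rightarrow> complex fps" where
  "rdb_series m = fps_const (of_nat m) * fps_X / (1 - (1 - fps_X) ^ m)"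

(* Reciprocal degenerate Bernoulli numbers: the coefficient of (1 - x)^k in the expansion above
   is (-1)^k times the k-th number divided by k!. *)
definition recip_degen_bernoulli :: "nat \<Rightarrow> nat \<Rightarrow> complex" where
  "recip_degen_bernoulli k m = (-1) ^ k * fact k * fps_nth (rdb_series m) k"

lemma fps_nth_one_minus_power_1:
  "fps_nth ((1 - fps_X) ^ m :: complex fps) 0 = 1"
  "fps_nth ((1 - fps_X) ^ m :: complex fps) 1 = - of_nat m"
proof -
  show 0: "fps_nth ((1 - fps_X) ^ m :: complex fps) 0 = 1" for m
    by (simp add: fps_nth_power_0)
  show "fps_nth ((1 - fps_X) ^ m :: complex fps) 1 = - of_nat m"
    by (induction m) (simp_all add: fps_mult_nth_1 0)
qed

lemma subdegree_one_minus_power: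
  assumes "m > 0"
  shows "subdegree (1 - (1 - fps_X) ^ m :: complex fps) = 1"
  using assms fps_nth_one_minus_power_1[of m] by (intro subdegreeI) auto

lemma recip_degen_bernoulli_sums:
  assumes "m > 0"
  shows "\<forall>\<^sub>F x in at (1::complex).
           (\<lambda>k. (-1) ^ k * (recip_degen_bernoulli k m / fact k) * (1 - x) ^ k)
             sums (of_nat m * (1 - x) / (1 - x ^ m))"
proof -
  let ?G = "1 - (1 - fps_X) ^ m :: complex fps"
  have nz: "?G \<noteq> 0"
    using subdegree_one_minus_power[OF assms] by (metis subdegree_0 zero_neq_one)
  have "(\<lambda>u. if u = 0 then 1
              else of_nat m * u / (1 - (1 - u) ^ m)) has_fps_expansion rdb_series m"
    unfolding rdb_series_def
    by (rule has_fps_expansion_divide)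
       (use assms nz subdegree_one_minus_power[OF assms] fps_nth_one_minus_power_1[of m] in
        \<open>auto intro!: fps_expansion_intros simp: subdegree_mult\<close>)
  hence ev: "\<forall>\<^sub>F u in nhds 0. eval_fps (rdb_series m) u =
                (if u = 0 then 1
                 else of_nat m * u / (1 - (1 - u) ^ m))"
    and R: "fps_conv_radius (rdb_series m) > 0"
    by (auto simp: has_fps_expansion_def)
  have "\<forall>\<^sub>F u in nhds 0. u \<in> eball 0 (fps_conv_radius (rdb_series m))"
    using R by (intro eventually_nhds_in_open) (auto simp: zero_ereal_def)
  with ev have "\<forall>\<^sub>F u in nhds 0. u \<noteq> 0 \<longrightarrow>
      (\<lambda>k. fps_nth (rdb_series m) k * u ^ k) sums (of_nat m * u / (1 - (1 - u) ^ m))"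
  proof eventually_elim
    case (elim u)
    hence "(\<lambda>k. fps_nth (rdb_series m) k * u ^ k) sums eval_fps (rdb_series m) u"
      by (intro sums_eval_fps) auto
    thus ?case using elim by auto
  qed
  hence *: "\<forall>\<^sub>F u in at 0. (\<lambda>k. fps_nth (rdb_series m) k * u ^ k)
              sums (of_nat m * u / (1 - (1 - u) ^ m))"
    by (simp add: eventually_at_filter)
  have "filterlim (\<lambda>x::complex. 1 - x) (at 0) (at 1)"
    by (auto simp: filterlim_at eventually_at_filter intro!: tendsto_eq_intros)
  from eventually_compose_filterlim[OF * this] show ?thesis
    by (simp add: recip_degen_bernoulli_def flip: power_mult_distrib mult.assoc)
qed

end

theory Submission
  imports Defs
begin

text \<open>
  The substitution \<open>u = 1 - exp (-z)\<close>, with \<open>du = exp (-z) dz\<close>, is a change of local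
  coordinate at the origin, so it preserves residues there.  It turns every factor \<open>1 - exp (-a z)\<close> into
  \<open>1 - (1 - u)^a\<close>, and \<open>exp (z t) dz\<close> into \<open>(1 - u)^(-t-1) du\<close>.  Hence the first Sylvester
  wave is the residue at \<open>u = 0\<close> of
  \<open>(1 - u)^(-t-1) / ((1 - (1 - u)^a\<^sub>1) \<dots> (1 - (1 - u)^a\<^sub>r))\<close>
  (\<open>first_sylvester_wave_eq_residue_transformed\<close>).

  With \<open>x = 1 - u\<close>, the reciprocal degenerate Bernoulli numbers of \<open>a\<close> are, up to sign and
  factorial, the Taylor coefficients of \<open>a u / (1 - (1 - u)^a)\<close>.  The transformed integrand is
  therefore \<open>u^(-r) / (a\<^sub>1 \<dots> a\<^sub>r)\<close> times the product of these series and of \<open>(1 - u)^(-t-1)\<close>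
  (\<open>transformed_integrand_laurent_expansion\<close>), and its residue is the coefficient of
  \<open>u^(r-1)\<close> in that product.  The factor \<open>(1 - u)^(-t-1)\<close> contributes the binomial coefficient
  at \<open>u^(r-1-j)\<close>, and the Bernoulli series contribute the sum over the
  decompositions of \<open>j\<close> into \<open>r\<close> nonnegative parts.

  The invariance of residues is proved for formal Laurent series
  (\<open>fls_residue_compose_fps\<close>): a series without residue is a derivative, and by the chain
  rule it stays a derivative after substitution; what remains is the logarithmic derivative
  of the substituted series, whose residue is the order of vanishing.
\<close>

section \<open>Change of variables in a residue\<close>

text \<open>
  The chain rule passes from power series to Laurent series by clearing denominators: both
  sides behave like derivations along composition with \<open>G\<close>, so their agreement on \<open>F * X^m\<close>
  and on \<open>X^m\<close> forces agreement on \<open>F\<close>.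
\<close>

lemma fls_deriv_compose_fps:
  fixes F :: "'a :: field fls" and G :: "'a fps"
  assumes G: "G \<noteq> 0" "fps_nth G 0 = 0"
  shows "fls_deriv (fls_compose_fps F G) =
           fls_compose_fps (fls_deriv F) G * fps_to_fls (fps_deriv G)"
proof -
  (* For F without a pole m is 0; otherwise it is the order of the pole. *)
  define m where "m = nat (- fls_subdegree F)"
  define P where "P = fls_regpart (fls_shift (- int m) F)"
  let ?X = "fps_to_fls (fps_X ^ m) :: 'a fls" and ?G = "fps_to_fls (G ^ m)"
  let ?c = "\<lambda>H. fls_compose_fps H G" and ?G' = "fps_to_fls (fps_deriv G)"
  have F: "F * ?X = fps_to_fls P"
    by (cases "F = 0")
       (simp_all add: P_def m_def fps_to_fls_power fls_X_power_times_conv_shift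
                      fls_regpart_to_fls_trivial)
  have X: "?c ?X = ?G"
    using G by (simp flip: fps_compose_power)
  have chain: "fls_deriv (?c (fps_to_fls Q)) = ?c (fls_deriv (fps_to_fls Q)) * ?G'" for Q
    using G by (simp add: fls_deriv_fps_to_fls fps_compose_deriv fls_times_fps_to_fls)
  have "fls_deriv (?c F) * ?G + ?c F * fls_deriv ?G = fls_deriv (?c (F * ?X))"
    using G by (simp add: fls_compose_fps_mult X add.commute del: fls_compose_fps_to_fls)
  also have "\<dots> = ?c (fls_deriv (F * ?X)) * ?G'"
    unfolding F by (rule chain)
  also have "\<dots> = (?c (fls_deriv F) * ?G') * ?G + ?c F * (?c (fls_deriv ?X) * ?G')"
    using G by (simp add: fls_compose_fps_mult fls_compose_fps_add X algebra_simps
                     del: fls_compose_fps_to_fls)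
  also have "?c (fls_deriv ?X) * ?G' = fls_deriv ?G"
    using chain[of "fps_X ^ m"] X by simp
  finally show ?thesis
    using G by simp
qed

text \<open>
  Only the term of exponent \<open>-1\<close> obstructs the existence of an antiderivative.  Substituting
  \<open>G\<close> maps derivatives to derivatives, which have no residue, and maps the obstructing term
  to a multiple of the logarithmic derivative \<open>G' / G\<close>.
\<close>

theorem fls_residue_compose_fps:
  fixes F :: "'a :: field_char_0 fls" and G :: "'a fps"
  assumes G: "G \<noteq> 0" "fps_nth G 0 = 0"
  shows "fls_residue (fls_compose_fps F G * fps_to_fls (fps_deriv G)) =
           of_nat (subdegree G) * fls_residue F"
proof -
  let ?c = "\<lambda>H. fls_compose_fps H G" and ?G' = "fps_to_fls (fps_deriv G)"
  define a where "a = fls_residue F"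
  have "fls_residue (F - fls_const a * inverse fls_X) = 0"
    by (simp add: a_def fls_inverse_X)
  then obtain H where "fls_deriv H = F - fls_const a * inverse fls_X"
    using fls_residue_nonzero_ex_antiderivative by blast
  hence F: "F = fls_deriv H + fls_const a * inverse fls_X"
    by simp
  have X: "?c fls_X = fps_to_fls G"
    using fls_compose_fps_to_fls[OF G, of fps_X] G by simp
  have "?c F * ?G' = fls_deriv (?c H) + fls_const a * (inverse (fps_to_fls G) * fls_deriv (fps_to_fls G))"
    unfolding F using G
    by (simp add: fls_compose_fps_add fls_compose_fps_mult fls_compose_fps_inverse X
                  fls_deriv_compose_fps fls_deriv_fps_to_fls algebra_simps)
  also have "fls_residue \<dots> = a * of_int (fls_subdegree (fps_to_fls G))"
    by (simp only: fls_residue_add fls_residue_deriv fls_residue_fls_const_times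
                   fls_residue_deriv_times_inverse_eq_subdegree) simp
  finally show ?thesis
    by (simp add: a_def fls_subdegree_fls_to_fps)
qed

corollary residue_change_of_variable:
  fixes f g :: "complex \<Rightarrow> complex"
  assumes f: "f has_laurent_expansion F"
    and g: "g has_fps_expansion G" "fps_nth G 0 = 0" "G \<noteq> 0"
  shows "residue (\<lambda>z. f (g z) * deriv g z) 0 = of_nat (subdegree G) * residue f 0"
proof -
  have gl: "g has_laurent_expansion fps_to_fls G"
    using g(1) by (rule has_laurent_expansion_fps)
  have "(\<lambda>z. (f \<circ> g) z * deriv g z) has_laurent_expansion
          fls_compose_fps F G * fls_deriv (fps_to_fls G)"
    by (intro laurent_expansion_intros f gl g)
  from has_laurent_expansion_residue_0[OF this] has_laurent_expansion_residue_0[OF f]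
  show ?thesis
    using fls_residue_compose_fps[of G F] g by (simp add: fls_deriv_fps_to_fls o_def)
qed

section \<open>Coefficients of the transformed integrand\<close>

lemma fps_nth_inverse_one_minus_X_power:
  "fps_nth (inverse ((1 - fps_X :: 'a :: field_char_0 fps) ^ Suc t)) n =
     of_nat ((t + n) choose t)"
proof -
  have "fps_nth (inverse ((1 - fps_X :: 'a fps) ^ Suc t)) n =
          (-1) ^ n * ((- of_nat (Suc t)) gchoose n)"
    using one_minus_fps_X_const_neg_power[of "1 :: 'a" "Suc t"]
    by (simp add: fps_compose_uminus' del: power_Suc)
  also have "\<dots> = (of_nat (t + n) :: 'a) gchoose n"
    using gbinomial_minus[of "of_nat (Suc t) :: 'a" n]
    by (simp add: add_ac flip: mult.assoc power_mult_distrib)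
  also have "\<dots> = of_nat ((t + n) choose t)"
    using binomial_symmetric[of n "t + n"] by (simp only: flip: binomial_gbinomial) simp
  finally show ?thesis .
qed

lemma rdb_series_mult:
  assumes "m > 0"
  shows "rdb_series m * (1 - (1 - fps_X) ^ m) = fps_const (of_nat m) * fps_X"
proof -
  let ?D = "1 - (1 - fps_X) ^ m :: complex fps"
  have "?D \<noteq> 0"
    using subdegree_one_minus_power[OF assms] by (metis subdegree_0 zero_neq_one)
  hence "?D dvd fps_const (of_nat m) * fps_X"
    using subdegree_one_minus_power[OF assms] assms
    by (subst fps_dvd_iff) (auto simp: subdegree_mult)
  thus ?thesis
    by (simp add: rdb_series_def)
qed

lemma fps_nth_rdb_series:
  "fps_nth (rdb_series m) k = (-1) ^ k * (recip_degen_bernoulli k m / fact k)"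
  by (simp add: recip_degen_bernoulli_def flip: power_mult_distrib mult.assoc)

text \<open>
  The sign and the factorials collect across the factors because the entries of \<open>js\<close> add up
  to \<open>j\<close>.
\<close>

lemma fps_nth_prod_rdb_series:
  assumes "r > 0"
  shows "fps_nth (\<Prod>i<r. rdb_series (A ! i)) j =
    (\<Sum>js \<in> {js :: nat list. length js = r \<and> sum_list js = j}.
        (-1) ^ j * ((\<Prod>i<r. recip_degen_bernoulli (js ! i) (A ! i)) / (\<Prod>i<r. fact (js ! i))))"
proof -
  have r: "{..<r} = {0..r - 1}" "r - 1 + 1 = r"
    using assms by auto
  have "fps_nth (\<Prod>i<r. rdb_series (A ! i)) j =
    (\<Sum>js \<in> natpermute j r. \<Prod>i<r. fps_nth (rdb_series (A ! i)) (js ! i))"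
    using fps_prod_nth[of "\<lambda>i. rdb_series (A ! i)" "r - 1" j] unfolding r .
  also have "\<dots> = (\<Sum>js \<in> natpermute j r. (-1) ^ j *
      ((\<Prod>i<r. recip_degen_bernoulli (js ! i) (A ! i)) / (\<Prod>i<r. fact (js ! i))))"
  proof (rule sum.cong[OF refl])
    fix js assume "js \<in> natpermute j r"
    hence "j = (\<Sum>i<r. js ! i)"
      by (auto simp: natpermute_def sum_list_sum_nth atLeast0LessThan)
    thus "(\<Prod>i<r. fps_nth (rdb_series (A ! i)) (js ! i)) = (-1) ^ j *
      ((\<Prod>i<r. recip_degen_bernoulli (js ! i) (A ! i)) / (\<Prod>i<r. fact (js ! i)))"
      by (simp add: fps_nth_rdb_series prod.distrib prod_dividef power_sum)
  qed
  finally show ?thesis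
    by (simp add: natpermute_def)
qed

section \<open>The polynomial part of the denumerant\<close>

text \<open>
  The exponent is \<open>t + 1\<close> because, in \<open>u = 1 - exp (-z)\<close>, the differential \<open>dz = du / (1 - u)\<close>
  contributes one more factor to \<open>exp (z t) = (1 - u)^(-t)\<close>.
\<close>

definition transformed_integrand :: "nat list \<Rightarrow> nat \<Rightarrow> complex \<Rightarrow> complex" where
  "transformed_integrand A t u =
     inverse ((1 - u) ^ Suc t) / (\<Prod>i<length A. 1 - (1 - u) ^ (A ! i))"

lemma first_sylvester_wave_eq_residue_transformed:
  assumes "transformed_integrand A t has_laurent_expansion F"
  shows "first_sylvester_wave A (of_nat t) = residue (transformed_integrand A t) 0"
proof -
  define g :: "complex \<Rightarrow> complex" where "g = (\<lambda>z. 1 - exp (- z))"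
  define G :: "complex fps" where "G = 1 - fps_exp (-1)"
  have g: "g has_fps_expansion G"
    using has_fps_expansion_exp[of "-1 :: complex"] unfolding g_def G_def
    by (auto intro!: fps_expansion_intros)
  have sub: "subdegree G = 1"
    by (intro subdegreeI) (auto simp: G_def)
  hence G: "fps_nth G 0 = 0" "G \<noteq> 0"
    by (auto simp: G_def)
  have deriv: "deriv g z = exp (- z)" for z
    unfolding g_def by (intro DERIV_imp_deriv) (auto intro!: derivative_eq_intros)
  have "exp (z * of_nat t) / (\<Prod>i<length A. 1 - exp (- (of_nat (A ! i) * z))) =
        transformed_integrand A t (g z) * deriv g z" for z
  proof -
    have "exp (- (of_nat n * z)) = exp (- z) ^ n" for n
      using exp_of_nat_mult[of n "- z"] by simp
    moreover have "exp (z * of_nat t) = inverse (exp (- z) ^ Suc t) * exp (- z)"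
      by (simp add: exp_of_nat2_mult exp_minus field_simps)
    ultimately show ?thesis
      unfolding transformed_integrand_def deriv by (simp add: g_def del: power_Suc)
  qed
  hence "first_sylvester_wave A (of_nat t) =
          residue (\<lambda>z. transformed_integrand A t (g z) * deriv g z) 0"
    by (simp add: first_sylvester_wave_def)
  also have "\<dots> = residue (transformed_integrand A t) 0"
    using residue_change_of_variable[OF assms g G] sub by simp
  finally show ?thesis .
qed

text \<open>
  Each factor \<open>1 - (1 - u)^a\<close> has a simple zero at \<open>u = 0\<close>.  Its reciprocal is \<open>1 / (a u)\<close>
  times the Bernoulli series of \<open>a\<close>, so the poles accumulate to a shift by the length of \<open>A\<close>.
\<close>

lemma transformed_integrand_laurent_expansion:
  assumes "\<forall>a\<in>set A. a > 0"
  shows "transformed_integrand A t has_laurent_expansion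
    fls_const (1 / (\<Prod>i<length A. of_nat (A ! i))) *
    fls_shift (length A) (fps_to_fls
      (inverse ((1 - fps_X) ^ Suc t) * (\<Prod>i<length A. rdb_series (A ! i))))"
proof -
  let ?D = "\<lambda>m. fps_to_fls (1 - (1 - fps_X) ^ m) :: complex fls"
  let ?E = "inverse ((1 - fps_X :: complex fps) ^ Suc t)"
  have D: "1 / ?D m = fls_const (1 / of_nat m) * fps_to_fls (rdb_series m) * fls_X_inv"
    if "m > 0" for m
  proof -
    have nz: "?D m \<noteq> 0"
      using subdegree_one_minus_power[OF that] by (metis fps_to_fls_eq_0_iff subdegree_0 zero_neq_one)
    have "fps_to_fls (rdb_series m) * ?D m = fls_const (of_nat m) * fls_X"
      unfolding fls_times_fps_to_fls [symmetric] rdb_series_mult[OF that]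
      by (simp add: fls_times_fps_to_fls)
    hence "fls_const (1 / of_nat m) * fps_to_fls (rdb_series m) * fls_X_inv * ?D m =
             (fls_const (1 / of_nat m) * fls_const (of_nat m)) * (fls_X * fls_X_inv)"
      by (metis (no_types, opaque_lifting) mult.assoc mult.commute)
    also have "\<dots> = 1"
      using that by (simp add: fls_const_mult_const fls_X_times_conv_shift)
    finally show ?thesis
      by (metis nonzero_eq_divide_eq[OF nz])
  qed
  have "transformed_integrand A t has_laurent_expansion
          fps_to_fls ?E / (\<Prod>i<length A. ?D (A ! i))"
    unfolding transformed_integrand_def
    by (intro laurent_expansion_intros has_laurent_expansion_fps fps_expansion_intros) simp
  also have "fps_to_fls ?E / (\<Prod>i<length A. ?D (A ! i)) = fps_to_fls ?E * (\<Prod>i<length A. 1 / ?D (A ! i))"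
    by (simp add: prod_dividef)
  also have "(\<Prod>i<length A. 1 / ?D (A ! i)) =
      (\<Prod>i<length A. fls_const (1 / of_nat (A ! i)) * fps_to_fls (rdb_series (A ! i)) * fls_X_inv)"
    using assms by (intro prod.cong refl D) auto
  also have "\<dots> = fls_const (1 / (\<Prod>i<length A. of_nat (A ! i))) *
      fps_to_fls (\<Prod>i<length A. rdb_series (A ! i)) * fls_X_inv ^ length A"
  proof -
    have "(\<Prod>i\<in>I. fls_const (f i)) = fls_const (\<Prod>i\<in>I. f i)" for f :: "nat \<Rightarrow> complex" and I
      by (induction I rule: infinite_finite_induct) (auto simp: fls_const_mult_const)
    moreover have "(\<Prod>i\<in>I. fps_to_fls (f i)) = fps_to_fls (\<Prod>i\<in>I. f i)" for f :: "nat \<Rightarrow> complex fps" and I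
      by (induction I rule: infinite_finite_induct) (auto simp: fls_times_fps_to_fls)
    ultimately show ?thesis
      by (simp add: prod.distrib prod_dividef)
  qed
  finally show ?thesis
    by (simp only: fls_times_fps_to_fls mult_ac flip: fls_X_inv_power_times_conv_shift(1))
qed

theorem theorem1p1p1:
  fixes A :: "nat list" and r t :: nat
  assumes "length A = r"
    and "\<forall>a\<in>set A. a > 0"
    and "Gcd (set A) = 1"
  shows "first_sylvester_wave A (of_nat t) =
    1 / (\<Prod>i<r. of_nat (A ! i)) *
    (\<Sum>j = 0..r - 1. \<Sum>js \<in> {js :: nat list. length js = r \<and> sum_list js = j}.
        (-1) ^ j * of_nat ((t + r - j - 1) choose t) *
        ((\<Prod>i<r. recip_degen_bernoulli (js ! i) (A ! i)) / (\<Prod>i<r. fact (js ! i))))"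
proof -
  (* The gcd of the empty tuple is 0, not 1. *)
  have r: "r > 0"
    using assms(1,3) by (cases A) auto
  let ?R = "\<Prod>i<r. rdb_series (A ! i)" and ?E = "inverse ((1 - fps_X :: complex fps) ^ Suc t)"
  note L = transformed_integrand_laurent_expansion[OF assms(2), of t, unfolded assms(1)]
  have "first_sylvester_wave A (of_nat t) =
          1 / (\<Prod>i<r. of_nat (A ! i)) * fps_nth (?R * ?E) (r - 1)"
    using first_sylvester_wave_eq_residue_transformed[OF L] has_laurent_expansion_residue_0[OF L] r
    by (simp add: nat_diff_distrib mult.commute del: power_Suc)
  also have "fps_nth (?R * ?E) (r - 1) =
      (\<Sum>j = 0..r - 1. fps_nth ?R j * of_nat ((t + r - j - 1) choose t))"
    unfolding fps_mult_nth
  proof (rule sum.cong[OF refl])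
    fix j assume "j \<in> {0..r - 1}"
    hence "t + (r - 1 - j) = t + r - j - 1"
      using r by auto
    thus "fps_nth ?R j * fps_nth ?E (r - 1 - j) =
            fps_nth ?R j * of_nat ((t + r - j - 1) choose t)"
      by (simp only: fps_nth_inverse_one_minus_X_power)
  qed
  finally show ?thesis
    by (simp only: fps_nth_prod_rdb_series[OF r] sum_distrib_right mult.assoc)
       (simp only: mult_ac)
qed

end
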